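(* Let $G$ be a graph with vertex set $V$ and let $w$ be a nonnegative real labeling of $G$. Then $$\vartheta(G,w)=\vartheta_1(G,w)=\vartheta_2(G,w)=\vartheta_3(G,w)=\vartheta_4(G,w).$$ Moreover, if $w\neq 0$ and $\vartheta=\vartheta(G,w)$, there exist orthogonal labelings $a$ of $G$ and $b$ of $\overline{G}$ such that $$c(a_v)=w_v/\vartheta\quad\text{for all }v\in V,\qquad\text{and}\qquad \sum_{v\in V} c(a_v)\,c(b_v)=1.$$
   Context: Graphs are finite, undirected and simple, with nonempty vertex set $V$. For distinct vertices, $u\sim v$ means adjacent and $u\not\sim v$ means not adjacent. $\overline{G}$ is the complement of $G$. A real labeling of $G$ is a vector $x=(x_v)_{v\in V}\in\mathbb{R}^V$; inequalities between vectors are componentwise. An orthogonal labeling $a$ of $G$ assigns to each vertex $v$ a vector $a_v=(a_{1v},\ldots,a_{dv})^T\in\mathbb{R}^d$ (the dimension $d\ge 1$ may be any positive integer, zero vectors are allowed) such that $a_u\cdot a_v=0$ whenever $u,v$ are distinct and nonadjacent in $G$. The cost is $c(a_v)=0$ if $a_v=0$, and $c(a_v)=a_{1v}^2/\Vert a_v\Vert^2$ otherwise. $\mathrm{TH}(G)=\{x\ge 0 : \sum_{v} c(a_v)x_v\le 1 \text{ for all orthogonal labelings } a \text{ of } G\}$, and for $w\ge 0$, $\vartheta(G,w)=\max\{w\cdot x : x\in \mathrm{TH}(G)\}$. $\vartheta_1(G,w)=\min_a\max_v\,(w_v/c(a_v))$ over all orthogonal labelings $a$ of $G$, where $w_v/c(a_v)$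 is $0$ if $w_v=c(a_v)=0$ and is $\infty$ if $w_v>0$ and $c(a_v)=0$. $\vartheta_2(G,w)=\min\{\Lambda(A): A \text{ is a feasible matrix for } G \text{ and } w\}$, where $\Lambda(A)$ is the largest eigenvalue of $A$, and $A$ is feasible if it is a real symmetric matrix indexed by $V$ with $A_{vv}=w_v$ for all $v$ and $A_{uv}=\sqrt{w_uw_v}$ whenever $u\not\sim v$ in $G$. $\vartheta_3(G,w)=\max\{\sum_{u,v\in V}(\sqrt{w_u}\,b_u)\cdot(\sqrt{w_v}\,b_v)\}$ over all orthogonal labelings $b$ of $\overline{G}$ that are normalized so that $\sum_v\Vert b_v\Vert^2=1$. $\vartheta_4(G,w)=\max\{\sum_{v}c(b_v)w_v : b \text{ is an orthogonal labeling of } \overline{G}\}$. *)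

theory Defs
  imports "HOL-Analysis.Analysis" "HOL-Library.Extended_Real"
begin

text \<open>The vertex set \<open>V\<close> is a finite (hence nonempty) type \<open>'v\<close>, and a graph on it is a
  symmetric irreflexive adjacency relation. Real labelings are vectors in \<open>real ^ 'v\<close>.\<close>

definition simple_graph :: "('v::finite \<Rightarrow> 'v \<Rightarrow> bool) \<Rightarrow> bool" where
  "simple_graph E \<longleftrightarrow> symp E \<and> irreflp E"

definition complement :: "('v \<Rightarrow> 'v \<Rightarrow> bool) \<Rightarrow> 'v \<Rightarrow> 'v \<Rightarrow> bool" where
  "complement E u v \<longleftrightarrow> u \<noteq> v \<and> \<not> E u v"

text \<open>The dimension \<open>d\<close> of an orthogonal labeling is quantified over, so a vector of \<open>d\<close> reals
  is a function \<open>nat \<Rightarrow> real\<close> of which only the values at \<open>0, \<dots>, d - 1\<close> are ever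
  used. The distinguished first coordinate has index \<open>0\<close>.\<close>

definition dot :: "nat \<Rightarrow> (nat \<Rightarrow> real) \<Rightarrow> (nat \<Rightarrow> real) \<Rightarrow> real" where
  "dot d x y = (\<Sum>i<d. x i * y i)"

definition orthogonal_labeling ::
    "('v::finite \<Rightarrow> 'v \<Rightarrow> bool) \<Rightarrow> nat \<Rightarrow> ('v \<Rightarrow> nat \<Rightarrow> real) \<Rightarrow> bool" where
  "orthogonal_labeling E d a \<longleftrightarrow>
     1 \<le> d \<and> (\<forall>u v. u \<noteq> v \<and> \<not> E u v \<longrightarrow> dot d (a u) (a v) = 0)"

definition cost :: "nat \<Rightarrow> (nat \<Rightarrow> real) \<Rightarrow> real" where
  "cost d x = (if \<forall>i<d. x i = 0 then 0 else (x 0)\<^sup>2 / dot d x x)"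

text \<open>\<open>GREATEST\<close> and \<open>LEAST\<close> below are unspecified when no maximum or minimum exists;
  attainment is expressed separately by the following two predicates.\<close>

definition has_max :: "'a::order set \<Rightarrow> bool" where
  "has_max S \<longleftrightarrow> (\<exists>m\<in>S. \<forall>s\<in>S. s \<le> m)"

definition has_min :: "'a::order set \<Rightarrow> bool" where
  "has_min S \<longleftrightarrow> (\<exists>m\<in>S. \<forall>s\<in>S. m \<le> s)"

definition TH :: "('v::finite \<Rightarrow> 'v \<Rightarrow> bool) \<Rightarrow> (real ^ 'v) set" where
  "TH E = {x. (\<forall>v. 0 \<le> x $ v) \<and>
     (\<forall>d a. orthogonal_labeling E d a \<longrightarrow> (\<Sum>v\<in>UNIV. cost d (a v) * x $ v) \<le> 1)}"

definition theta_values :: "('v::finite \<Rightarrow> 'v \<Rightarrow> bool) \<Rightarrow> real ^ 'v \<Rightarrow> real set" where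
  "theta_values E w = {w \<bullet> x | x. x \<in> TH E}"

definition theta :: "('v::finite \<Rightarrow> 'v \<Rightarrow> bool) \<Rightarrow> real ^ 'v \<Rightarrow> real" where
  "theta E w = (GREATEST t. t \<in> theta_values E w)"

definition ratio :: "real \<Rightarrow> real \<Rightarrow> ereal" where
  "ratio p c = (if c = 0 then (if p = 0 then 0 else \<infinity>) else ereal (p / c))"

definition theta1_values :: "('v::finite \<Rightarrow> 'v \<Rightarrow> bool) \<Rightarrow> real ^ 'v \<Rightarrow> ereal set" where
  "theta1_values E w =
     {Max (range (\<lambda>v. ratio (w $ v) (cost d (a v)))) | d a. orthogonal_labeling E d a}"

definition theta1 :: "('v::finite \<Rightarrow> 'v \<Rightarrow> bool) \<Rightarrow> real ^ 'v \<Rightarrow> ereal" where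
  "theta1 E w = (LEAST t. t \<in> theta1_values E w)"

definition eigenvalue :: "real ^ 'v ^ 'v \<Rightarrow> real \<Rightarrow> bool" where
  "eigenvalue A l \<longleftrightarrow> (\<exists>x. x \<noteq> 0 \<and> A *v x = l *s x)"

definition largest_eigenvalue :: "real ^ 'v ^ 'v \<Rightarrow> real" where
  "largest_eigenvalue A = (GREATEST l. eigenvalue A l)"

definition feasible :: "('v::finite \<Rightarrow> 'v \<Rightarrow> bool) \<Rightarrow> real ^ 'v \<Rightarrow> real ^ 'v ^ 'v \<Rightarrow> bool" where
  "feasible E w A \<longleftrightarrow> transpose A = A \<and> (\<forall>v. A $ v $ v = w $ v) \<and>
     (\<forall>u v. u \<noteq> v \<and> \<not> E u v \<longrightarrow> A $ u $ v = sqrt (w $ u * w $ v))"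

definition theta2_values :: "('v::finite \<Rightarrow> 'v \<Rightarrow> bool) \<Rightarrow> real ^ 'v \<Rightarrow> real set" where
  "theta2_values E w = {largest_eigenvalue A | A. feasible E w A}"

definition theta2 :: "('v::finite \<Rightarrow> 'v \<Rightarrow> bool) \<Rightarrow> real ^ 'v \<Rightarrow> real" where
  "theta2 E w = (LEAST t. t \<in> theta2_values E w)"

definition theta3_values :: "('v::finite \<Rightarrow> 'v \<Rightarrow> bool) \<Rightarrow> real ^ 'v \<Rightarrow> real set" where
  "theta3_values E w =
     {\<Sum>u\<in>UNIV. \<Sum>v\<in>UNIV. dot d (\<lambda>i. sqrt (w $ u) * b u i) (\<lambda>i. sqrt (w $ v) * b v i) | d b.
        orthogonal_labeling (complement E) d b \<and> (\<Sum>v\<in>UNIV. dot d (b v) (b v)) = 1}"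

definition theta3 :: "('v::finite \<Rightarrow> 'v \<Rightarrow> bool) \<Rightarrow> real ^ 'v \<Rightarrow> real" where
  "theta3 E w = (GREATEST t. t \<in> theta3_values E w)"

definition theta4_values :: "('v::finite \<Rightarrow> 'v \<Rightarrow> bool) \<Rightarrow> real ^ 'v \<Rightarrow> real set" where
  "theta4_values E w =
     {\<Sum>v\<in>UNIV. cost d (b v) * w $ v | d b. orthogonal_labeling (complement E) d b}"

definition theta4 :: "('v::finite \<Rightarrow> 'v \<Rightarrow> bool) \<Rightarrow> real ^ 'v \<Rightarrow> real" where
  "theta4 E w = (GREATEST t. t \<in> theta4_values E w)"

end

theory Submission
  imports Defs
begin

text \<open>Write \<open>q\<close> for the vector with entries \<open>sqrt w\<^sub>v\<close>. The functions \<open>theta2\<close> and \<open>theta3\<close>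
  are dual semidefinite programs. The first minimizes \<open>m\<close> such that \<open>m I - A\<close> is positive semidefinite,
  where \<open>A\<close> agrees with \<open>q q\<^sup>T\<close> outside the edges. In terms of the Gram matrix \<open>B\<close> of the
  labeling, the second maximizes \<open>q \<bullet> B q\<close> over the positive semidefinite \<open>B\<close> of
  trace one that vanish at the edges. For such \<open>A\<close> and \<open>B\<close> the number \<open>q \<bullet> B q\<close> is the trace of
  \<open>A B\<close>, which is at most \<open>m\<close> (\<open>theta3_le_of_feasible\<close>). There is no gap, and both optima are
  attained (\<open>strong_duality\<close>): if \<open>r\<close> exceeds all values \<open>q \<bullet> B q\<close>, a hyperplane that separates \<open>r\<close>
  from what the positive semidefinite matrices of trace one attain yields an \<open>A\<close> for \<open>m = r\<close>, and
  compactness gives one for the maximum itself.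

  The other three functions lie between these two. A labeling for \<open>theta3\<close>, rotated so that
  \<open>\<Sum>\<^sub>v sqrt w\<^sub>v b\<^sub>v\<close> points along the first axis, gives at least the same value for \<open>theta4\<close>
  (\<open>theta4_ge_of_edge_free\<close>). The costs of a labeling of the complement form a point of \<open>TH\<close>,
  because for every labeling \<open>a\<close> of the graph the vectors \<open>a\<^sub>v \<otimes> b\<^sub>v\<close> are pairwise orthogonal and
  satisfy Bessel's inequality
  (\<open>sum_cost_product_le_1\<close>). The bound of \<open>theta\<close> by \<open>theta1\<close> is immediate from the inequalities
  that define \<open>TH\<close>. And Gram vectors of \<open>m I - A + q q\<^sup>T\<close> with first coordinates \<open>q\<^sub>v\<close> are
  an orthogonal labeling with costs \<open>w\<^sub>v / m\<close> (\<open>labeling_of_feasible\<close>), which bounds \<open>theta1\<close> by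
  \<open>m\<close>. For the optimal \<open>A\<close> this is the labeling with costs \<open>w\<^sub>v / theta\<close>, and an optimal labeling for \<open>theta4\<close>
  is its partner in the last claim.\<close>

section \<open>Quadratic forms and positive semidefinite matrices\<close>

definition psd :: "real ^ 'n ^ 'n \<Rightarrow> bool" where
  "psd M \<longleftrightarrow> (\<forall>u v. M $ u $ v = M $ v $ u) \<and> (\<forall>x. 0 \<le> x \<bullet> (M *v x))"

definition outer :: "real ^ 'n \<Rightarrow> real ^ 'n ^ 'n" where
  "outer y = (\<chi> u v. y $ u * y $ v)"

lemma inner_matrix_vector_expand:
  fixes M :: "real ^ 'n ^ 'n"
  shows "x \<bullet> (M *v y) = (\<Sum>u\<in>UNIV. \<Sum>v\<in>UNIV. x $ u * (M $ u $ v * y $ v))"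
  by (simp add: inner_vec_def matrix_vector_mult_def sum_distrib_left)

lemma inner_outer: "x \<bullet> (outer y *v z) = (x \<bullet> y) * (y \<bullet> z)"
  unfolding inner_matrix_vector_expand
  by (simp add: inner_vec_def sum_product outer_def mult_ac)

lemma inner_mat: "x \<bullet> (mat t *v y) = t * (x \<bullet> y)" for t :: real
proof -
  have "(\<Sum>v\<in>UNIV. (if u = v then t else 0) * y $ v) = t * y $ u" for u
    by (simp add: if_distrib if_distribR sum.delta cong: if_cong)
  then show ?thesis
    by (simp add: inner_vec_def matrix_vector_mult_def mat_def sum_distrib_left mult_ac)
qed

lemma inner_axis_matrix: "axis u 1 \<bullet> (M *v axis v 1) = M $ u $ v"
  for M :: "real ^ 'n ^ 'n"
  by (simp add: inner_axis' matrix_vector_mult_basis column_def)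

lemma inner_matrix_symmetric:
  fixes M :: "real ^ 'n ^ 'n"
  assumes "\<And>u v. M $ u $ v = M $ v $ u"
  shows "x \<bullet> (M *v y) = y \<bullet> (M *v x)"
  unfolding inner_matrix_vector_expand
  by (subst sum.swap) (simp add: assms mult_ac)

lemma continuous_inner_matrix:
  "continuous_on S (\<lambda>M. x \<bullet> (M *v y))" for S :: "(real ^ 'n ^ 'n) set"
  unfolding inner_matrix_vector_expand by (intro continuous_intros)

text \<open>A nonnegative quadratic polynomial in one variable, here \<open>t \<mapsto> (x + t y) \<bullet> M (x + t y)\<close>,
  has nonpositive discriminant.\<close>

lemma psd_Cauchy_Schwarz:
  assumes "psd M"
  shows "(x \<bullet> (M *v y))\<^sup>2 \<le> (x \<bullet> (M *v x)) * (y \<bullet> (M *v y))"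
proof -
  define a b c where "a = y \<bullet> (M *v y)" and "b = x \<bullet> (M *v y)" and "c = x \<bullet> (M *v x)"
  have sym: "y \<bullet> (M *v x) = b"
    unfolding b_def using assms by (intro inner_matrix_symmetric) (simp add: psd_def)
  have quad: "0 \<le> c + 2 * t * b + t\<^sup>2 * a" for t
  proof -
    have "0 \<le> (x + t *\<^sub>R y) \<bullet> (M *v (x + t *\<^sub>R y))"
      using assms by (simp add: psd_def)
    also have "\<dots> = c + 2 * t * b + t\<^sup>2 * a"
      by (simp add: matrix_vector_right_distrib matrix_vector_mult_scaleR inner_add_left
          inner_add_right sym a_def c_def power2_eq_square algebra_simps flip: b_def)
    finally show ?thesis .
  qed
  have a0: "0 \<le> a" using assms by (simp add: psd_def a_def)
  have "b\<^sup>2 \<le> c * a"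
  proof (cases "a = 0")
    case True
    have "b = 0"
    proof (rule ccontr)
      assume "b \<noteq> 0"
      then show False
        using quad[of "- (c + 1) / (2 * b)"] True by (simp add: field_simps)
    qed
    then show ?thesis using True by simp
  next
    case False
    then have "a > 0" using a0 by simp
    moreover have "0 \<le> c - b\<^sup>2 / a"
      using quad[of "- b / a"] False by (simp add: power2_eq_square field_simps)
    ultimately show ?thesis by (simp add: field_simps)
  qed
  then show ?thesis by (simp add: a_def b_def c_def)
qed

lemma psd_diagonal_nonneg: "psd M \<Longrightarrow> 0 \<le> M $ v $ v"
  unfolding psd_def by (metis inner_axis_matrix)

lemma psd_entry_square: "psd M \<Longrightarrow> (M $ u $ v)\<^sup>2 \<le> M $ u $ u * M $ v $ v"
  using psd_Cauchy_Schwarz[of M "axis u 1" "axis v 1"] by (simp add: inner_axis_matrix)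

lemma psd_entry_le_trace:
  assumes "psd M"
  shows "\<bar>M $ u $ v\<bar> \<le> trace M"
proof -
  have d: "M $ i $ i \<le> trace M" for i
    unfolding trace_def using psd_diagonal_nonneg[OF assms] by (intro member_le_sum) auto
  have "(M $ u $ v)\<^sup>2 \<le> (trace M)\<^sup>2"
    unfolding power2_eq_square[of "trace M"]
    using psd_entry_square[OF assms, of u v] d[of u] d[of v]
      psd_diagonal_nonneg[OF assms, of u] psd_diagonal_nonneg[OF assms, of v]
    by (smt (verit) mult_mono)
  moreover have "0 \<le> trace M"
    using d[of u] psd_diagonal_nonneg[OF assms, of u] by linarith
  ultimately show ?thesis using abs_le_square_iff[of "M $ u $ v" "trace M"] by simp
qed

lemma psd_outer: "psd (outer y)"
  by (simp add: psd_def inner_outer inner_commute) (simp add: outer_def mult.commute)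

lemma psd_add: "psd M \<Longrightarrow> psd N \<Longrightarrow> psd (M + N)"
  by (simp add: psd_def matrix_vector_mult_add_rdistrib inner_add_right)

lemma psd_scaleR: "psd M \<Longrightarrow> 0 \<le> r \<Longrightarrow> psd (r *\<^sub>R M)"
  by (simp add: psd_def scaleR_matrix_vector_assoc [symmetric])

lemma inner_mat_diff: "x \<bullet> ((mat t - A) *v y) = t * (x \<bullet> y) - x \<bullet> (A *v y)" for t :: real
  by (simp add: matrix_vector_mult_diff_rdistrib inner_diff_right inner_mat)

lemma psd_mat_diff_iff:
  assumes "\<And>u v. A $ u $ v = A $ v $ u"
  shows "psd (mat t - A) \<longleftrightarrow> (\<forall>x. x \<bullet> (A *v x) \<le> t * (x \<bullet> x))"
  unfolding psd_def inner_mat_diff by (auto simp: mat_def assms)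

lemma psd_mat_diff_from_unit_vectors:
  assumes sym: "\<And>u v. A $ u $ v = A $ v $ u"
    and unit: "\<And>x. norm x = 1 \<Longrightarrow> x \<bullet> (A *v x) \<le> t"
  shows "psd (mat t - A)"
proof -
  have "x \<bullet> (A *v x) \<le> t * (x \<bullet> x)" for x
  proof (cases "x = 0")
    case False
    then show ?thesis
      using unit[of "x /\<^sub>R norm x"]
      by (simp add: matrix_vector_mult_scaleR field_simps power2_eq_square dot_square_norm)
  qed simp
  then show ?thesis by (simp add: psd_mat_diff_iff[OF sym])
qed

lemma closed_psd: "closed {M :: real ^ 'n ^ 'n. psd M}"
  unfolding psd_def
  by (intro closed_Collect_conj closed_Collect_all closed_Collect_eq closed_Collect_le
      continuous_inner_matrix continuous_intros)

lemma bounded_matrix_entries: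
  assumes "\<And>M u v. M \<in> S \<Longrightarrow> \<bar>(M :: real ^ 'n ^ 'n) $ u $ v\<bar> \<le> T"
  shows "bounded S"
proof (rule boundedI)
  fix M assume "M \<in> S"
  have "norm (M $ u) \<le> (\<Sum>v\<in>(UNIV :: 'n set). T)" for u
    by (rule order_trans[OF norm_le_l1_cart sum_mono]) (simp add: assms \<open>M \<in> S\<close>)
  then have "(\<Sum>u\<in>UNIV. norm (M $ u)) \<le> (\<Sum>u\<in>(UNIV :: 'n set). \<Sum>v\<in>(UNIV :: 'n set). T)"
    by (intro sum_mono)
  moreover have "norm M \<le> (\<Sum>u\<in>UNIV. norm (M $ u))"
    by (simp add: norm_vec_def L2_set_le_sum)
  ultimately show "norm M \<le> (\<Sum>u\<in>(UNIV :: 'n set). \<Sum>v\<in>(UNIV :: 'n set). T)"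
    by linarith
qed

section \<open>Gram vectors\<close>

text \<open>In terms of Gram vectors \<open>b\<^sub>v\<close> of \<open>M\<close>, the vector \<open>y\<close> subtracted here lists the components
  of the \<open>b\<^sub>v\<close> along the unit vector in direction \<open>s = \<Sum>\<^sub>v q\<^sub>v b\<^sub>v\<close>, and what remains is the Gram
  matrix of the projections to the orthogonal complement of \<open>s\<close>. If \<open>s = 0\<close>, division by zero
  makes \<open>y\<close> the zero vector, as it should be.\<close>

lemma psd_minus_outer:
  assumes "psd M"
  shows "psd (M - outer ((1 / sqrt (q \<bullet> (M *v q))) *\<^sub>R (M *v q)))"
proof -
  define s where "s = q \<bullet> (M *v q)"
  have s: "0 \<le> s" using assms by (simp add: psd_def s_def)
  have "0 \<le> x \<bullet> (M *v x) - (x \<bullet> (M *v q))\<^sup>2 / s" for x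
  proof (cases "s = 0")
    case False
    then show ?thesis
      using psd_Cauchy_Schwarz[OF assms, of x q] s by (simp add: field_simps flip: s_def)
  qed (use assms in \<open>simp add: psd_def\<close>)
  moreover have "x \<bullet> ((M - outer ((1 / sqrt s) *\<^sub>R (M *v q))) *v x)
      = x \<bullet> (M *v x) - (x \<bullet> (M *v q))\<^sup>2 / s" for x
    using s by (simp add: matrix_vector_mult_diff_rdistrib inner_diff_right inner_outer
        inner_commute[of "M *v q"] power2_eq_square)
  ultimately show ?thesis
    using assms by (simp add: psd_def outer_def flip: s_def)
qed

lemma dot_Suc_case:
  "dot (Suc d) (case_nat x f) (case_nat y g) = x * y + dot d f g"
  by (simp add: dot_def sum.lessThan_Suc_shift del: sum.lessThan_Suc)

text \<open>This is the Cholesky decomposition: each step subtracts one \<open>outer y\<close> that clears the row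
  and the column of an index \<open>p\<close>, and \<open>y\<close> supplies one more coordinate of the Gram vectors.\<close>

lemma psd_gram_supported:
  fixes M :: "real ^ 'n::finite ^ 'n"
  assumes "finite S" "psd M" "\<And>u v. u \<notin> S \<Longrightarrow> M $ u $ v = 0"
  shows "\<exists>d b. \<forall>u v. dot d (b u) (b v) = M $ u $ v"
  using assms
proof (induction S arbitrary: M rule: finite_induct)
  case empty
  then have "\<forall>u v. dot 0 (\<lambda>_. 0) (\<lambda>_. 0) = M $ u $ v" by (simp add: dot_def)
  then show ?case by (intro exI[of _ 0] exI[of _ "\<lambda>_ _. 0"])
next
  case (insert p S)
  define y where "y = (1 / sqrt (M $ p $ p)) *\<^sub>R (M *v axis p 1)"
  have y: "y $ u = M $ u $ p / sqrt (M $ p $ p)" for u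
    by (simp add: y_def matrix_vector_mult_basis column_def)
  define N where "N = M - outer y"
  have "psd N"
    unfolding N_def y_def
    using psd_minus_outer[OF insert.prems(1), of "axis p 1"] by (simp add: inner_axis_matrix)
  have sym: "M $ u $ v = M $ v $ u" for u v
    using insert.prems(1) by (simp add: psd_def)
  have entry: "N $ u $ v = M $ u $ v - M $ u $ p * M $ v $ p / M $ p $ p" for u v
    using psd_diagonal_nonneg[OF insert.prems(1), of p] by (simp add: N_def outer_def y)
  have "N $ u $ v = 0" if "u \<notin> S" for u v
  proof (cases "u = p")
    case True
    show ?thesis
    proof (cases "M $ p $ p = 0")
      case True
      \<comment> \<open>a zero on the diagonal forces the whole row to vanish\<close>
      then show ?thesis
        using psd_entry_square[OF insert.prems(1), of p v] \<open>u = p\<close> by (simp add: entry)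
    qed (simp add: entry \<open>u = p\<close> sym[of p v])
  next
    case False
    then show ?thesis using that insert.prems(2) by (simp add: entry)
  qed
  then obtain d b where db: "\<And>u v. dot d (b u) (b v) = N $ u $ v"
    using insert.IH[OF \<open>psd N\<close>] by blast
  have "\<forall>u v. dot (Suc d) (case_nat (y $ u) (b u)) (case_nat (y $ v) (b v)) = M $ u $ v"
    by (simp add: dot_Suc_case db N_def outer_def)
  then show ?case by (intro exI[of _ "Suc d"] exI[of _ "\<lambda>v. case_nat (y $ v) (b v)"])
qed

text \<open>The cost of a labeling sees only its Gram matrix and its first coordinates, so this lemma
  is how every labeling below is constructed.\<close>

lemma gram_with_first_coordinate:
  fixes P :: "real ^ 'n::finite ^ 'n"
  assumes "psd (P - outer y)"
  obtains d b where "1 \<le> d" "\<And>u v. dot d (b u) (b v) = P $ u $ v" "\<And>v. b v 0 = y $ v"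
proof -
  obtain d b where db: "\<And>u v. dot d (b u) (b v) = (P - outer y) $ u $ v"
    using psd_gram_supported[of UNIV, OF _ assms] by auto
  show ?thesis
    by (rule that[of "Suc d" "\<lambda>v. case_nat (y $ v) (b v)"])
      (simp_all add: dot_Suc_case db outer_def)
qed

definition gram :: "nat \<Rightarrow> ('n \<Rightarrow> nat \<Rightarrow> real) \<Rightarrow> real ^ 'n ^ 'n" where
  "gram d b = (\<chi> u v. dot d (b u) (b v))"

text \<open>Splitting a Gram matrix into the contributions \<open>outer (\<chi> v. b\<^sub>v i)\<close> of the coordinates \<open>i\<close>
  turns the trace of \<open>A\<close> times \<open>gram d b\<close> into a sum of values of the quadratic form of \<open>A\<close>.\<close>

lemma sum_entries_gram:
  fixes A :: "real ^ 'n::finite ^ 'n"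
  shows "(\<Sum>u\<in>UNIV. \<Sum>v\<in>UNIV. A $ u $ v * dot d (b u) (b v))
    = (\<Sum>i<d. (\<chi> v. b v i) \<bullet> (A *v (\<chi> v. b v i)))"
proof -
  have "(\<Sum>u\<in>UNIV. \<Sum>v\<in>UNIV. A $ u $ v * dot d (b u) (b v))
      = (\<Sum>u\<in>UNIV. \<Sum>i<d. \<Sum>v\<in>UNIV. A $ u $ v * (b u i * b v i))"
    unfolding dot_def sum_distrib_left by (intro sum.cong refl sum.swap)
  also have "\<dots> = (\<Sum>i<d. \<Sum>u\<in>UNIV. \<Sum>v\<in>UNIV. A $ u $ v * (b u i * b v i))"
    by (rule sum.swap)
  finally show ?thesis by (simp add: inner_matrix_vector_expand mult_ac)
qed

lemma psd_gram: "psd (gram d (b :: 'n::finite \<Rightarrow> nat \<Rightarrow> real))"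
proof -
  have "x \<bullet> (gram d b *v x) = (\<Sum>i<d. (\<chi> v. b v i) \<bullet> (outer x *v (\<chi> v. b v i)))" for x
    unfolding sum_entries_gram[symmetric]
    by (simp add: inner_matrix_vector_expand outer_def gram_def mult_ac)
  then show ?thesis
    unfolding psd_def by (auto simp: gram_def dot_def inner_outer inner_commute mult.commute
        intro!: sum_nonneg)
qed

section \<open>The largest eigenvalue\<close>

lemma eigenvalue_le:
  assumes "eigenvalue A l" "psd (mat t - A)"
  shows "l \<le> t"
proof -
  obtain x where x: "x \<noteq> 0" "A *v x = l *s x" using assms(1) by (auto simp: eigenvalue_def)
  have "0 \<le> x \<bullet> ((mat t - A) *v x)" using assms(2) by (simp add: psd_def)
  also have "\<dots> = (t - l) * (x \<bullet> x)"
    by (simp add: inner_mat_diff x(2) scalar_mult_eq_scaleR left_diff_distrib)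
  finally have "0 \<le> (t - l) * (x \<bullet> x)" .
  moreover have "0 < x \<bullet> x" using x(1) by simp
  ultimately show ?thesis using mult_neg_pos[of "t - l" "x \<bullet> x"] by linarith
qed

text \<open>The maximum \<open>l\<close> of the quadratic form of \<open>A\<close> on the unit sphere is an eigenvalue: at a
  maximizer the form of the positive semidefinite matrix \<open>l I - A\<close> vanishes, so by Cauchy-Schwarz
  the maximizer lies in its kernel.\<close>

lemma largest_eigenvalue:
  fixes A :: "real ^ 'n::finite ^ 'n"
  assumes sym: "\<And>u v. A $ u $ v = A $ v $ u"
  shows "psd (mat (largest_eigenvalue A) - A)"
    and "psd (mat t - A) \<Longrightarrow> largest_eigenvalue A \<le> t"
proof -
  have "continuous_on (sphere 0 1) (\<lambda>x. x \<bullet> (A *v x))"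
    unfolding inner_matrix_vector_expand by (intro continuous_intros)
  moreover have "axis undefined 1 \<in> (sphere 0 1 :: (real ^ 'n) set)" by simp
  ultimately obtain e where e: "e \<in> sphere 0 1"
    and max: "\<And>x. x \<in> sphere 0 1 \<Longrightarrow> x \<bullet> (A *v x) \<le> e \<bullet> (A *v e)"
    using continuous_attains_sup[of "sphere 0 1 :: (real ^ 'n) set" "\<lambda>x. x \<bullet> (A *v x)"]
    by (metis compact_sphere empty_iff)
  define l where "l = e \<bullet> (A *v e)"
  have psd: "psd (mat l - A)"
    by (rule psd_mat_diff_from_unit_vectors[OF sym]) (simp add: l_def max)
  have "x \<bullet> ((mat l - A) *v e) = 0" for x
    using psd_Cauchy_Schwarz[OF psd, of x e] e
    by (simp add: l_def inner_mat_diff norm_eq_sqrt_inner)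
  then have "x \<bullet> (A *v e - l *s e) = 0" for x
    by (simp add: inner_mat_diff inner_diff_right scalar_mult_eq_scaleR)
  then have "A *v e = l *s e" by (metis inner_eq_zero_iff right_minus_eq)
  moreover have "e \<noteq> 0" using e by auto
  ultimately have "eigenvalue A l" by (auto simp: eigenvalue_def)
  then have "largest_eigenvalue A = l"
    unfolding largest_eigenvalue_def using psd by (intro Greatest_equality eigenvalue_le) auto
  then show "psd (mat (largest_eigenvalue A) - A)"
    and "psd (mat t - A) \<Longrightarrow> largest_eigenvalue A \<le> t"
    using psd eigenvalue_le[OF \<open>eigenvalue A l\<close>] by auto
qed

section \<open>Weak duality\<close>

lemma cost_eq: "1 \<le> d \<Longrightarrow> cost d x = (x 0)\<^sup>2 / dot d x x"
  by (auto simp: cost_def dot_def)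

lemma cost_nonneg: "0 \<le> cost d x"
  by (auto simp: cost_def dot_def intro!: divide_nonneg_nonneg sum_nonneg)

text \<open>Bessel's inequality for the unit vector with index \<open>k\<close> and the normalized vectors
  \<open>f\<^sub>v\<close>; a zero vector contributes \<open>0 / 0 = 0\<close>.\<close>

lemma Bessel_unit_vector:
  fixes f :: "'v::finite \<Rightarrow> 'i \<Rightarrow> real"
  assumes "finite I" "k \<in> I"
    and orth: "\<And>u v. u \<noteq> v \<Longrightarrow> (\<Sum>i\<in>I. f u i * f v i) = 0"
  shows "(\<Sum>v\<in>UNIV. (f v k)\<^sup>2 / (\<Sum>i\<in>I. f v i * f v i)) \<le> 1"
proof -
  define n where "n v = (\<Sum>i\<in>I. f v i * f v i)" for v
  define p where "p i = (\<Sum>v\<in>UNIV. f v k / n v * f v i)" for i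
  define e where "e i = (if i = k then 1 else 0 :: real)" for i
  have ep: "(\<Sum>i\<in>I. e i * p i) = (\<Sum>v\<in>UNIV. (f v k)\<^sup>2 / n v)"
  proof -
    have "(\<Sum>i\<in>I. e i * p i) = p k"
      using assms(1,2) by (simp add: e_def if_distrib if_distribR sum.delta cong: if_cong)
    then show ?thesis by (simp add: p_def power2_eq_square)
  qed
  have "(\<Sum>i\<in>I. p i * p i)
      = (\<Sum>i\<in>I. \<Sum>u\<in>UNIV. \<Sum>v\<in>UNIV. f u k / n u * (f v k / n v) * (f u i * f v i))"
    by (simp add: p_def sum_product mult_ac)
  also have "\<dots> = (\<Sum>u\<in>UNIV. \<Sum>i\<in>I. \<Sum>v\<in>UNIV. f u k / n u * (f v k / n v) * (f u i * f v i))"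
    by (rule sum.swap)
  also have "\<dots> = (\<Sum>u\<in>UNIV. \<Sum>v\<in>UNIV. \<Sum>i\<in>I. f u k / n u * (f v k / n v) * (f u i * f v i))"
    by (intro sum.cong refl sum.swap)
  also have "\<dots> = (\<Sum>u\<in>UNIV. \<Sum>v\<in>UNIV. if u = v then (f v k)\<^sup>2 / n v else 0)"
  proof (intro sum.cong refl)
    fix u v
    have "(\<Sum>i\<in>I. f u k / n u * (f v k / n v) * (f u i * f v i))
        = f u k / n u * (f v k / n v) * (\<Sum>i\<in>I. f u i * f v i)"
      by (simp add: sum_distrib_left)
    also have "\<dots> = (if u = v then (f v k)\<^sup>2 / n v else 0)"
      using orth[of u v] by (auto simp: n_def power2_eq_square)
    finally show "(\<Sum>i\<in>I. f u k / n u * (f v k / n v) * (f u i * f v i))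
        = (if u = v then (f v k)\<^sup>2 / n v else 0)" .
  qed
  also have "\<dots> = (\<Sum>v\<in>UNIV. (f v k)\<^sup>2 / n v)" by simp
  finally have pp: "(\<Sum>i\<in>I. p i * p i) = (\<Sum>v\<in>UNIV. (f v k)\<^sup>2 / n v)" .
  have ee: "(\<Sum>i\<in>I. e i * e i) = 1"
    using assms(1,2) by (simp add: e_def if_distrib if_distribR sum.delta cong: if_cong)
  have "0 \<le> (\<Sum>i\<in>I. (e i - p i)\<^sup>2)" by (intro sum_nonneg) simp
  also have "\<dots> = (\<Sum>i\<in>I. e i * e i) - 2 * (\<Sum>i\<in>I. e i * p i) + (\<Sum>i\<in>I. p i * p i)"
    by (simp add: power2_eq_square algebra_simps sum.distrib sum_subtractf sum_distrib_left)
  finally show ?thesis by (simp add: ep pp ee n_def)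
qed

text \<open>Distinct vertices are nonadjacent in \<open>E\<close> or in its complement, so the tensor products
  \<open>a\<^sub>v \<otimes> b\<^sub>v\<close> are pairwise orthogonal. Their costs are the products of the costs.\<close>

lemma sum_cost_product_le_1:
  assumes a: "orthogonal_labeling E d a" and b: "orthogonal_labeling (complement E) d' b"
  shows "(\<Sum>v\<in>UNIV. cost d (a v) * cost d' (b v)) \<le> 1"
proof -
  have d: "1 \<le> d" "1 \<le> d'" using a b by (auto simp: orthogonal_labeling_def)
  define f where "f v = (\<lambda>x. a v (fst x) * b v (snd x))" for v
  have f_dot: "(\<Sum>x\<in>{..<d} \<times> {..<d'}. f u x * f v x) = dot d (a u) (a v) * dot d' (b u) (b v)"
    for u v
    unfolding dot_def sum_product sum.cartesian_product
    by (simp add: f_def case_prod_beta mult_ac)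
  have "dot d (a u) (a v) = 0 \<or> dot d' (b u) (b v) = 0" if "u \<noteq> v" for u v
    using a b that by (auto simp: orthogonal_labeling_def complement_def)
  then have "(\<Sum>v\<in>UNIV. (f v (0, 0))\<^sup>2 / (\<Sum>x\<in>{..<d} \<times> {..<d'}. f v x * f v x)) \<le> 1"
    using d by (intro Bessel_unit_vector) (auto simp: f_dot)
  then show ?thesis
    unfolding f_dot using d by (simp add: cost_eq f_def power_mult_distrib)
qed

lemma theta4_values_subset: "theta4_values E w \<subseteq> theta_values E w"
proof
  fix t assume "t \<in> theta4_values E w"
  then obtain d b where b: "orthogonal_labeling (complement E) d b"
    and t: "t = (\<Sum>v\<in>UNIV. cost d (b v) * w $ v)"
    by (auto simp: theta4_values_def)
  define x where "x = (\<chi> v. cost d (b v))"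
  have "x \<in> TH E"
    using sum_cost_product_le_1[OF _ b] by (auto simp: TH_def x_def cost_nonneg)
  moreover have "t = w \<bullet> x" by (simp add: t x_def inner_vec_def mult.commute)
  ultimately show "t \<in> theta_values E w" by (auto simp: theta_values_def)
qed

lemma theta_le_theta1:
  assumes w: "\<And>v. 0 \<le> w $ v" and t: "t \<in> theta_values E w" and s: "s \<in> theta1_values E w"
  shows "ereal t \<le> s"
proof -
  obtain x where x: "x \<in> TH E" "t = w \<bullet> x" using t by (auto simp: theta_values_def)
  obtain d a where a: "orthogonal_labeling E d a"
    and s_eq: "s = Max (range (\<lambda>v. ratio (w $ v) (cost d (a v))))"
    using s by (auto simp: theta1_values_def)
  have le: "ratio (w $ v) (cost d (a v)) \<le> s" for v
    unfolding s_eq by (intro Max_ge) auto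
  have "0 \<le> ratio (w $ v) (cost d (a v))" for v
    using w[of v] cost_nonneg[of d "a v"] by (auto simp: ratio_def)
  then have "0 \<le> s" using le order_trans by blast
  then consider "s = \<infinity>" | r where "s = ereal r" "0 \<le> r" by (cases s) auto
  then show ?thesis
  proof cases
    case 2
    have x0: "0 \<le> x $ v" for v using x(1) by (simp add: TH_def)
    have "w $ v \<le> r * cost d (a v)" for v
      using le[of v] 2 cost_nonneg[of d "a v"]
      by (auto simp: ratio_def field_simps split: if_splits)
    then have "t \<le> (\<Sum>v\<in>UNIV. r * cost d (a v) * x $ v)"
      unfolding x(2) inner_vec_def by (auto intro!: sum_mono mult_right_mono x0)
    also have "\<dots> = r * (\<Sum>v\<in>UNIV. cost d (a v) * x $ v)"
      by (simp add: sum_distrib_left mult_ac)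
    also have "\<dots> \<le> r * 1"
      using x(1) a 2 by (intro mult_left_mono) (auto simp: TH_def)
    finally show ?thesis using 2 by simp
  qed simp
qed

section \<open>From matrices to labelings\<close>

definition sqrt_vec :: "real ^ 'v \<Rightarrow> real ^ 'v" where
  "sqrt_vec w = (\<chi> v. sqrt (w $ v))"

lemma feasible_symmetric: "feasible E w A \<Longrightarrow> A $ u $ v = A $ v $ u"
  by (auto simp: feasible_def transpose_def vec_eq_iff)

text \<open>The matrix \<open>m I - A + q q\<^sup>T\<close> with \<open>q = sqrt_vec w\<close> has \<open>m\<close> on its diagonal and vanishes at
  nonadjacent pairs. Gram vectors for it with first coordinates \<open>q\<^sub>v\<close> have costs \<open>w\<^sub>v / m\<close>.
  If \<open>m = 0\<close>, then all \<open>w\<^sub>v\<close> and all costs are zero.\<close>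

lemma labeling_of_feasible:
  fixes E :: "'v::finite \<Rightarrow> 'v \<Rightarrow> bool"
  assumes w: "\<And>v. 0 \<le> w $ v" and A: "feasible E w A" and psd: "psd (mat m - A)"
  obtains d a where "orthogonal_labeling E d a" "\<And>v. cost d (a v) = w $ v / m"
proof -
  define P where "P = mat m - A + outer (sqrt_vec w)"
  obtain d a where d: "1 \<le> d" and P: "\<And>u v. dot d (a u) (a v) = P $ u $ v"
    and first: "\<And>v. a v 0 = sqrt_vec w $ v"
    using gram_with_first_coordinate[of P "sqrt_vec w"] psd by (auto simp: P_def)
  have diag: "P $ v $ v = m" for v
    using A w[of v] by (simp add: P_def mat_def outer_def sqrt_vec_def feasible_def)
  have "P $ u $ v = 0" if "u \<noteq> v" "\<not> E u v" for u v
    using A that by (simp add: P_def mat_def outer_def sqrt_vec_def feasible_def real_sqrt_mult)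
  then have "orthogonal_labeling E d a" using d by (simp add: orthogonal_labeling_def P)
  moreover have "cost d (a v) = w $ v / m" for v
    using d w[of v] by (simp add: cost_eq P diag first sqrt_vec_def)
  ultimately show ?thesis by (rule that)
qed

lemma weight_le_of_feasible:
  assumes "feasible E w A" "psd (mat m - A)"
  shows "w $ v \<le> m"
  using psd_diagonal_nonneg[OF assms(2), of v] assms(1) by (simp add: mat_def feasible_def)

lemma theta1_le_of_feasible:
  fixes E :: "'v::finite \<Rightarrow> 'v \<Rightarrow> bool"
  assumes w: "\<And>v. 0 \<le> w $ v" and A: "feasible E w A" and psd: "psd (mat m - A)"
  obtains s where "s \<in> theta1_values E w" "s \<le> ereal m"
proof -
  obtain d a where a: "orthogonal_labeling E d a" and c: "\<And>v. cost d (a v) = w $ v / m"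
    by (rule labeling_of_feasible[OF assms]) (rule that)
  have "ratio (w $ v) (cost d (a v)) \<le> ereal m" for v
    using weight_le_of_feasible[OF A psd, of v] w[of v] by (auto simp: ratio_def c)
  then have "Max (range (\<lambda>v. ratio (w $ v) (cost d (a v)))) \<le> ereal m" by simp
  then show ?thesis using a by (intro that) (auto simp: theta1_values_def)
qed

text \<open>The normalized labelings that define \<open>theta3\<close> matter only through their Gram matrices,
  which form the following convex set.\<close>

definition edge_free :: "('v::finite \<Rightarrow> 'v \<Rightarrow> bool) \<Rightarrow> (real ^ 'v ^ 'v) set" where
  "edge_free E = {B. psd B \<and> trace B = 1 \<and> (\<forall>u v. u \<noteq> v \<and> E u v \<longrightarrow> B $ u $ v = 0)}"

lemma theta3_values_eq:
  fixes E :: "'v::finite \<Rightarrow> 'v \<Rightarrow> bool"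
  shows "theta3_values E w = (\<lambda>B. sqrt_vec w \<bullet> (B *v sqrt_vec w)) ` edge_free E"
proof -
  have val: "(\<Sum>u\<in>UNIV. \<Sum>v\<in>UNIV. dot d (\<lambda>i. sqrt (w $ u) * b u i) (\<lambda>i. sqrt (w $ v) * b v i))
      = sqrt_vec w \<bullet> (gram d b *v sqrt_vec w)" for d and b :: "'v \<Rightarrow> nat \<Rightarrow> real"
    unfolding inner_matrix_vector_expand
    by (simp add: gram_def dot_def sqrt_vec_def sum_distrib_left sum_distrib_right mult_ac)
  have gram: "orthogonal_labeling (complement E) d b \<and> (\<Sum>v\<in>UNIV. dot d (b v) (b v)) = 1
      \<longleftrightarrow> 1 \<le> d \<and> gram d b \<in> edge_free E" for d and b :: "'v \<Rightarrow> nat \<Rightarrow> real"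
    using psd_gram[of d b]
    by (auto simp: orthogonal_labeling_def complement_def edge_free_def gram_def trace_def)
  have onto: "\<exists>d b. 1 \<le> d \<and> gram d b = B" if B: "B \<in> edge_free E" for B
  proof -
    have "outer 0 = (0 :: real ^ 'v ^ 'v)" by (simp add: outer_def vec_eq_iff)
    then have "psd (B - outer 0)" using B by (simp add: edge_free_def)
    then obtain d b where "1 \<le> d" "\<And>u v. dot d (b u) (b v) = B $ u $ v"
      by (rule gram_with_first_coordinate) (rule that)
    then have "1 \<le> d \<and> gram d b = B" by (simp add: gram_def vec_eq_iff)
    then show ?thesis by blast
  qed
  have "theta3_values E w
      = {sqrt_vec w \<bullet> (gram d b *v sqrt_vec w) | d b. 1 \<le> d \<and> gram d b \<in> edge_free E}"
    unfolding theta3_values_def val gram ..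
  also have "\<dots> = (\<lambda>B. sqrt_vec w \<bullet> (B *v sqrt_vec w)) ` edge_free E"
    using onto by blast
  finally show ?thesis .
qed

text \<open>Take the direction of \<open>\<Sum>\<^sub>v sqrt w\<^sub>v b\<^sub>v\<close> as the first coordinate axis. By Cauchy-Schwarz,
  the square of the length of this sum is at most \<open>(\<Sum>\<^sub>v w\<^sub>v c(b\<^sub>v)) (\<Sum>\<^sub>v \<parallel>b\<^sub>v\<parallel>\<^sup>2)\<close>.\<close>

lemma theta4_ge_of_edge_free:
  fixes E :: "'v::finite \<Rightarrow> 'v \<Rightarrow> bool"
  assumes w: "\<And>v. 0 \<le> w $ v" and B: "B \<in> edge_free E"
  obtains t where "t \<in> theta4_values E w" "sqrt_vec w \<bullet> (B *v sqrt_vec w) \<le> t"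
proof -
  define q where "q = sqrt_vec w"
  define S where "S = q \<bullet> (B *v q)"
  define y where "y = (1 / sqrt S) *\<^sub>R (B *v q)"
  have "psd B" using B by (simp add: edge_free_def)
  have S0: "0 \<le> S" using \<open>psd B\<close> by (simp add: psd_def S_def)
  have psd: "psd (B - outer y)"
    unfolding y_def S_def by (rule psd_minus_outer[OF \<open>psd B\<close>])
  obtain d b where d: "1 \<le> d" and gram: "\<And>u v. dot d (b u) (b v) = B $ u $ v"
    and first: "\<And>v. b v 0 = y $ v"
    by (rule gram_with_first_coordinate[OF psd]) (rule that)
  have b: "orthogonal_labeling (complement E) d b"
    using B d by (auto simp: orthogonal_labeling_def complement_def edge_free_def gram)
  have B0: "0 \<le> B $ v $ v" for v by (rule psd_diagonal_nonneg[OF \<open>psd B\<close>])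
  have "y $ v = 0" if "B $ v $ v = 0" for v
    using psd_diagonal_nonneg[OF psd, of v] that
    by (simp add: outer_def) (metis not_real_square_gt_zero not_le)
  then have split: "q $ v * y $ v = (q $ v * y $ v / sqrt (B $ v $ v)) * sqrt (B $ v $ v)" for v
    by (cases "B $ v $ v = 0") auto
  have "S = (q \<bullet> y)\<^sup>2"
    using S0 by (simp add: y_def power_divide flip: S_def) (simp add: power2_eq_square)
  also have "\<dots> = (\<Sum>v\<in>UNIV. (q $ v * y $ v / sqrt (B $ v $ v)) * sqrt (B $ v $ v))\<^sup>2"
    unfolding split[symmetric] by (simp add: inner_vec_def)
  also have "\<dots> \<le> (\<Sum>v\<in>UNIV. (q $ v * y $ v / sqrt (B $ v $ v))\<^sup>2) * (\<Sum>v\<in>UNIV. (sqrt (B $ v $ v))\<^sup>2)"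
    by (rule Cauchy_Schwarz_ineq_sum)
  also have "(\<Sum>v\<in>UNIV. (sqrt (B $ v $ v))\<^sup>2) = 1"
    using B B0 by (simp add: edge_free_def trace_def)
  also have "(\<Sum>v\<in>UNIV. (q $ v * y $ v / sqrt (B $ v $ v))\<^sup>2) = (\<Sum>v\<in>UNIV. cost d (b v) * w $ v)"
    using d w B0 by (simp add: cost_eq gram first q_def sqrt_vec_def power_divide
        power_mult_distrib mult.commute)
  finally have "S \<le> (\<Sum>v\<in>UNIV. cost d (b v) * w $ v)" by simp
  then show ?thesis
    using b by (intro that) (auto simp: theta4_values_def S_def q_def)
qed

text \<open>Wherever \<open>A\<close> and \<open>outer (sqrt_vec w)\<close> differ, the Gram matrix vanishes. So a value of
  \<open>theta3\<close> is the trace of \<open>A\<close> times a positive semidefinite matrix of trace one.\<close>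

lemma theta3_le_of_feasible:
  fixes E :: "'v::finite \<Rightarrow> 'v \<Rightarrow> bool"
  assumes w: "\<And>v. 0 \<le> w $ v" and t: "t \<in> theta3_values E w"
    and A: "feasible E w A" and psd: "psd (mat m - A)"
  shows "t \<le> m"
proof -
  obtain d b where b: "orthogonal_labeling (complement E) d b"
    and norm: "(\<Sum>v\<in>UNIV. dot d (b v) (b v)) = 1"
    and t_eq: "t = (\<Sum>u\<in>UNIV. \<Sum>v\<in>UNIV.
      dot d (\<lambda>i. sqrt (w $ u) * b u i) (\<lambda>i. sqrt (w $ v) * b v i))"
    using t by (auto simp: theta3_values_def)
  have "dot d (\<lambda>i. sqrt (w $ u) * b u i) (\<lambda>i. sqrt (w $ v) * b v i)
      = A $ u $ v * dot d (b u) (b v)" for u v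
  proof -
    have "dot d (\<lambda>i. sqrt (w $ u) * b u i) (\<lambda>i. sqrt (w $ v) * b v i)
        = sqrt (w $ u) * sqrt (w $ v) * dot d (b u) (b v)"
      by (simp add: dot_def sum_distrib_left mult_ac)
    moreover consider "u = v" | "u \<noteq> v" "E u v" | "u \<noteq> v" "\<not> E u v" by blast
    then have "sqrt (w $ u) * sqrt (w $ v) = A $ u $ v \<or> dot d (b u) (b v) = 0"
      using A b w[of u]
      by cases (auto simp: feasible_def orthogonal_labeling_def complement_def real_sqrt_mult)
    ultimately show ?thesis by auto
  qed
  then have "t = (\<Sum>i<d. (\<chi> v. b v i) \<bullet> (A *v (\<chi> v. b v i)))"
    by (simp add: t_eq sum_entries_gram)
  also have "\<dots> \<le> (\<Sum>i<d. (\<chi> v. b v i) \<bullet> (mat m *v (\<chi> v. b v i)))"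
  proof (rule sum_mono)
    fix i
    show "(\<chi> v. b v i) \<bullet> (A *v (\<chi> v. b v i)) \<le> (\<chi> v. b v i) \<bullet> (mat m *v (\<chi> v. b v i))"
      using psd psd_mat_diff_iff[OF feasible_symmetric[OF A], of m] by (simp add: inner_mat)
  qed
  also have "\<dots> = m * (\<Sum>v\<in>UNIV. dot d (b v) (b v))"
    unfolding inner_mat sum_distrib_left[symmetric] dot_def
    by (subst sum.swap) (simp add: inner_vec_def)
  finally show ?thesis using norm by simp
qed

section \<open>Strong duality\<close>

lemma convex_psd_trace_1: "convex {B :: real ^ 'v::finite ^ 'v. psd B \<and> trace B = 1}"
proof -
  have "trace (r *\<^sub>R B + s *\<^sub>R C) = r * trace B + s * trace C" for r s and B C :: "real ^ 'v ^ 'v"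
    by (simp add: trace_def sum.distrib sum_distrib_left)
  then show ?thesis by (auto intro!: convexI psd_add psd_scaleR)
qed

lemma compact_psd_trace_1: "compact {B :: real ^ 'v::finite ^ 'v. psd B \<and> trace B = 1}"
  unfolding compact_eq_bounded_closed
proof
  show "bounded {B :: real ^ 'v ^ 'v. psd B \<and> trace B = 1}"
    by (rule bounded_matrix_entries[of _ 1]) (use psd_entry_le_trace in fastforce)
  show "closed {B :: real ^ 'v ^ 'v. psd B \<and> trace B = 1}"
    unfolding trace_def
    by (intro closed_Collect_conj closed_psd closed_Collect_eq continuous_intros)
qed

lemma edge_free_nonempty: "edge_free E \<noteq> {}"
proof -
  have "outer (axis i 1) $ u $ v = (if u = i \<and> v = i then 1 else 0 :: real)" for i u v :: 'a
    by (simp add: outer_def axis_def)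
  then have "outer (axis undefined 1) \<in> edge_free E"
    by (simp add: edge_free_def psd_outer trace_def)
  then show ?thesis by blast
qed

lemma compact_edge_free: "compact (edge_free E)"
proof -
  have "edge_free E = {B. psd B \<and> trace B = 1}
      \<inter> (\<Inter>u. \<Inter>v. {B. u \<noteq> v \<and> E u v \<longrightarrow> B $ u $ v = 0})"
    by (auto simp: edge_free_def)
  then show ?thesis
    by (auto intro!: compact_Int_closed compact_psd_trace_1 closed_INT closed_Collect_imp
        closed_Collect_eq continuous_intros)
qed

text \<open>Map each positive semidefinite \<open>B\<close> of trace one to the pair of the objective \<open>q \<bullet> B q\<close> and
  the entries of \<open>B\<close> at edges. The image is compact and convex and, since the objective is at most
  \<open>m\<close> on \<open>edge_free E\<close>, misses \<open>(r, 0)\<close> for \<open>r > m\<close>. In a separating hyperplane the coefficient of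
  the objective is positive, and the remaining coefficients, scaled by it, are
  the correction to \<open>q q\<^sup>T\<close> at the edges; the separation says that the form of the corrected matrix
  is below \<open>r\<close> on the unit sphere, as one sees from the matrices \<open>outer x\<close>.\<close>

lemma feasible_near_optimal:
  fixes E :: "'v::finite \<Rightarrow> 'v \<Rightarrow> bool"
  assumes E: "simple_graph E" and w: "\<And>v. 0 \<le> w $ v"
    and m: "\<And>B. B \<in> edge_free E \<Longrightarrow> sqrt_vec w \<bullet> (B *v sqrt_vec w) \<le> m" and r: "m < r"
  obtains A where "feasible E w A" "psd (mat r - A)"
proof -
  define q where "q = sqrt_vec w"
  define \<Delta> where "\<Delta> = {B :: real ^ 'v ^ 'v. psd B \<and> trace B = 1}"
  define R where "R B = (\<chi> u v. if E u v then B $ u $ v else 0)" for B :: "real ^ 'v ^ 'v"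
  define F where "F B = (q \<bullet> (B *v q), R B)" for B
  have lin: "linear F"
    by (rule linearI) (auto simp: F_def R_def vec_eq_iff matrix_vector_mult_add_rdistrib
        inner_add_right simp flip: scaleR_matrix_vector_assoc)
  have "convex (F ` \<Delta>)"
    unfolding \<Delta>_def by (intro convex_linear_image lin convex_psd_trace_1)
  moreover have "closed (F ` \<Delta>)"
    unfolding \<Delta>_def
    by (intro compact_imp_closed compact_continuous_image linear_continuous_on
        linear_conv_bounded_linear[THEN iffD1] lin compact_psd_trace_1)
  moreover have "(r, 0) \<notin> F ` \<Delta>"
  proof
    assume "(r, 0) \<in> F ` \<Delta>"
    then obtain B where B: "B \<in> \<Delta>" "q \<bullet> (B *v q) = r" "R B = 0" by (auto simp: F_def)
    have "B $ u $ v = 0" if "E u v" for u v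
      using arg_cong[OF B(3), of "\<lambda>M. M $ u $ v"] that by (simp add: R_def)
    then have "B \<in> edge_free E" using B(1) by (simp add: edge_free_def \<Delta>_def)
    then show False using m[of B] B(2) r by (simp add: q_def)
  qed
  ultimately obtain n c where less: "n \<bullet> (r, 0) < c" and greater: "\<And>B. B \<in> \<Delta> \<Longrightarrow> c < n \<bullet> F B"
    using separating_hyperplane_closed_point[of "F ` \<Delta>" "(r, 0)"] by blast
  \<comment> \<open>signs are flipped so that the image of \<open>\<Delta>\<close> lies below the point\<close>
  obtain \<alpha> D where n: "n = (- \<alpha>, - D)" by (metis minus_minus surj_pair)
  have sep: "\<alpha> * (q \<bullet> (B *v q)) + D \<bullet> R B < \<alpha> * r" if "B \<in> \<Delta>" for B
    using less greater[OF that] by (simp add: n F_def)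
  obtain B0 where B0: "B0 \<in> edge_free E" using edge_free_nonempty by blast
  have "R B0 = 0"
    using B0 E by (auto simp: R_def edge_free_def vec_eq_iff simple_graph_def irreflp_def) metis
  then have "\<alpha> * (q \<bullet> (B0 *v q)) < \<alpha> * r"
    using sep[of B0] B0 by (simp add: \<Delta>_def edge_free_def)
  moreover have "q \<bullet> (B0 *v q) < r" using m[OF B0] r by (simp add: q_def)
  ultimately have \<alpha>: "0 < \<alpha>" unfolding mult_less_cancel_left by linarith
  \<comment> \<open>\<open>D\<close> need not be symmetric, but only its symmetric part matters to the quadratic form\<close>
  define C where "C = (\<chi> u v. if E u v then (D $ u $ v + D $ v $ u) / (2 * \<alpha>) else 0)"
  define A where "A = outer q + C"
  have Esym: "E u v \<longleftrightarrow> E v u" for u v using E by (auto simp: simple_graph_def symp_def)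
  have Eirr: "\<not> E v v" for v using E by (auto simp: simple_graph_def irreflp_def)
  have "feasible E w A"
    using w Eirr Esym by (auto simp: feasible_def A_def C_def outer_def q_def sqrt_vec_def
        transpose_def vec_eq_iff real_sqrt_mult add.commute mult.commute)
  moreover have "psd (mat r - A)"
  proof -
    have C: "\<alpha> * (x \<bullet> (C *v x)) = D \<bullet> R (outer x)" for x
    proof -
      define g where "g u v = (if E u v then D $ u $ v * (x $ u * x $ v) else 0)" for u v
      have g: "\<alpha> * (x $ u * (C $ u $ v * x $ v)) = (g u v + g v u) / 2" for u v
        using \<alpha> Esym[of u v] by (simp add: C_def g_def field_simps)
      have "\<alpha> * (x \<bullet> (C *v x)) = (\<Sum>u\<in>UNIV. \<Sum>v\<in>UNIV. (g u v + g v u) / 2)"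
        by (simp only: inner_matrix_vector_expand sum_distrib_left g)
      also have "\<dots> = ((\<Sum>u\<in>UNIV. \<Sum>v\<in>UNIV. g u v) + (\<Sum>u\<in>UNIV. \<Sum>v\<in>UNIV. g v u)) / 2"
        by (simp add: sum.distrib sum_divide_distrib add_divide_distrib)
      also have "(\<Sum>u\<in>UNIV. \<Sum>v\<in>UNIV. g v u) = (\<Sum>u\<in>UNIV. \<Sum>v\<in>UNIV. g u v)"
        by (rule sum.swap)
      also have "(\<Sum>u\<in>UNIV. \<Sum>v\<in>UNIV. g u v) = D \<bullet> R (outer x)"
        by (simp add: g_def inner_vec_def R_def outer_def if_distrib cong: if_cong)
      finally show ?thesis by simp
    qed
    have unit: "x \<bullet> (A *v x) \<le> r" if "norm x = 1" for x
    proof -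
      have "outer x \<in> \<Delta>"
        using that by (simp add: \<Delta>_def psd_outer)
          (simp add: trace_def outer_def norm_eq_sqrt_inner inner_vec_def)
      then have "\<alpha> * (q \<bullet> (outer x *v q)) + \<alpha> * (x \<bullet> (C *v x)) < \<alpha> * r"
        using sep C by simp
      then have "q \<bullet> (outer x *v q) + x \<bullet> (C *v x) < r"
        using \<alpha> by (simp flip: distrib_left)
      then show ?thesis
        by (simp add: A_def matrix_vector_mult_add_rdistrib inner_add_right inner_outer
            inner_commute)
    qed
    show ?thesis
      by (rule psd_mat_diff_from_unit_vectors[OF feasible_symmetric[OF \<open>feasible E w A\<close>] unit])
  qed
  ultimately show ?thesis by (rule that)
qed

text \<open>If \<open>r I - A\<close> is positive semidefinite, the trace bounds its entries, and the trace is
  determined by \<open>r\<close> and the prescribed diagonal of \<open>A\<close>.\<close>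

lemma compact_feasible_level: "compact {A. feasible E w A \<and> psd (mat r - A)}"
  unfolding compact_eq_bounded_closed
proof
  define T where "T = (\<Sum>v\<in>UNIV. r - w $ v) + \<bar>r\<bar>"
  show "bounded {A. feasible E w A \<and> psd (mat r - A)}"
  proof (rule bounded_matrix_entries)
    fix A u v assume "A \<in> {A. feasible E w A \<and> psd (mat r - A)}"
    then have "\<bar>(mat r - A) $ u $ v\<bar> \<le> (\<Sum>v\<in>UNIV. r - w $ v)"
      using psd_entry_le_trace[of "mat r - A" u v] by (simp add: trace_def mat_def feasible_def)
    then show "\<bar>A $ u $ v\<bar> \<le> T" by (auto simp: T_def mat_def split: if_splits)
  qed
  have "closed {A. feasible E w A}"
    unfolding feasible_def transpose_def vec_eq_iff vec_lambda_beta
    by (intro closed_Collect_conj closed_Collect_all closed_Collect_imp closed_Collect_eq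
        continuous_intros) simp
  moreover have "closed {A. psd (mat r - A)}"
    using continuous_closed_vimage[OF closed_psd, of "\<lambda>A. mat r - A"]
    by (simp add: vimage_def continuous_intros)
  ultimately show "closed {A. feasible E w A \<and> psd (mat r - A)}"
    by (rule closed_Collect_conj)
qed

text \<open>The matrices \<open>A\<close> that are optimal up to \<open>1 / (n + 1)\<close> form a decreasing sequence of nonempty
  compact sets, and an element of the intersection is optimal.\<close>

lemma strong_duality:
  fixes E :: "'v::finite \<Rightarrow> 'v \<Rightarrow> bool"
  assumes E: "simple_graph E" and w: "\<And>v. 0 \<le> w $ v"
  obtains A B where "feasible E w A" "B \<in> edge_free E"
    "psd (mat (sqrt_vec w \<bullet> (B *v sqrt_vec w)) - A)"
proof -
  obtain B where B: "B \<in> edge_free E"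
    and max: "\<And>B'. B' \<in> edge_free E
      \<Longrightarrow> sqrt_vec w \<bullet> (B' *v sqrt_vec w) \<le> sqrt_vec w \<bullet> (B *v sqrt_vec w)"
    using continuous_attains_sup[OF compact_edge_free edge_free_nonempty continuous_inner_matrix]
    by metis
  define m where "m = sqrt_vec w \<bullet> (B *v sqrt_vec w)"
  define L where "L n = {A. feasible E w A \<and> psd (mat (m + inverse (real (Suc n))) - A)}" for n
  have "\<Inter> (range L) \<noteq> {}"
  proof (rule compact_nest)
    show "compact (L n)" for n unfolding L_def by (rule compact_feasible_level)
    show "L n \<noteq> {}" for n
      using feasible_near_optimal[OF E w max, of "m + inverse (real (Suc n))"]
      by (auto simp: L_def m_def)
    show "L j \<subseteq> L i" if "i \<le> j" for i j
    proof
      fix A assume A: "A \<in> L j"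
      have le: "inverse (real (Suc j)) \<le> inverse (real (Suc i))" using that by simp
      have "feasible E w A" using A by (simp add: L_def)
      note iff = psd_mat_diff_iff[OF feasible_symmetric[OF this]]
      have "x \<bullet> (A *v x) \<le> (m + inverse (real (Suc i))) * (x \<bullet> x)" for x
      proof -
        have "x \<bullet> (A *v x) \<le> (m + inverse (real (Suc j))) * (x \<bullet> x)"
          using A unfolding L_def mem_Collect_eq iff by blast
        also have "\<dots> \<le> (m + inverse (real (Suc i))) * (x \<bullet> x)"
          using le by (intro mult_right_mono add_left_mono inner_ge_zero)
        finally show ?thesis .
      qed
      then show "A \<in> L i" using \<open>feasible E w A\<close> unfolding L_def mem_Collect_eq iff by blast
    qed
  qed
  then obtain A where A: "\<And>n. A \<in> L n" by blast
  have feas: "feasible E w A" using A by (simp add: L_def)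
  note iff = psd_mat_diff_iff[OF feasible_symmetric[OF feas]]
  have "x \<bullet> (A *v x) \<le> m * (x \<bullet> x)" for x
  proof (rule LIMSEQ_le_const)
    show "(\<lambda>n. (m + inverse (real (Suc n))) * (x \<bullet> x)) \<longlonglongrightarrow> m * (x \<bullet> x)"
      using LIMSEQ_inverse_real_of_nat_add[of m] by (intro tendsto_intros)
    have "x \<bullet> (A *v x) \<le> (m + inverse (real (Suc n))) * (x \<bullet> x)" for n
      using A[of n] unfolding L_def mem_Collect_eq iff by blast
    then show "\<exists>N. \<forall>n\<ge>N. x \<bullet> (A *v x) \<le> (m + inverse (real (Suc n))) * (x \<bullet> x)" by blast
  qed
  then have "psd (mat m - A)" unfolding iff by blast
  then show ?thesis using that feas B by (simp add: m_def)
qed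

section \<open>The equality of the five parameters\<close>

theorem theorem12:
  fixes E :: "'v::finite \<Rightarrow> 'v \<Rightarrow> bool" and w :: "real ^ 'v"
  assumes "simple_graph E"
    and "\<forall>v. 0 \<le> w $ v"
  shows "(has_max (theta_values E w) \<and> has_min (theta1_values E w) \<and>
           has_min (theta2_values E w) \<and> has_max (theta3_values E w) \<and>
           has_max (theta4_values E w)) \<and>
         (ereal (theta E w) = theta1 E w \<and> theta E w = theta2 E w \<and>
           theta E w = theta3 E w \<and> theta E w = theta4 E w) \<and>
         (w \<noteq> 0 \<longrightarrow>
           (\<exists>d a d' b. orthogonal_labeling E d a \<and>
              orthogonal_labeling (complement E) d' b \<and>
              (\<forall>v. cost d (a v) = w $ v / theta E w) \<and>
              (\<Sum>v\<in>UNIV. cost d (a v) * cost d' (b v)) = 1))"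
proof -
  have w: "0 \<le> w $ v" for v using assms(2) by simp
  \<comment> \<open>All five value sets contain \<open>m\<close>, and the weak inequalities make it extremal in each.\<close>
  obtain A B where A: "feasible E w A" and B: "B \<in> edge_free E"
    and psd: "psd (mat (sqrt_vec w \<bullet> (B *v sqrt_vec w)) - A)"
    using strong_duality[OF assms(1) w] .
  define m where "m = sqrt_vec w \<bullet> (B *v sqrt_vec w)"
  note psd = psd[folded m_def]
  have in3: "m \<in> theta3_values E w" using B by (auto simp: theta3_values_eq m_def)
  have le3: "t \<le> m" if "t \<in> theta3_values E w" for t
    by (rule theta3_le_of_feasible[OF w that A psd])
  have ge2: "m \<le> t" if t: "t \<in> theta2_values E w" for t
  proof -
    obtain A' where A': "feasible E w A'" "t = largest_eigenvalue A'"
      using t by (auto simp: theta2_values_def)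
    show ?thesis
      unfolding A'(2)
      using theta3_le_of_feasible[OF w in3 A'(1)] largest_eigenvalue(1) feasible_symmetric[OF A'(1)]
      by blast
  qed
  have "largest_eigenvalue A \<le> m"
    using largest_eigenvalue(2)[OF _ psd] feasible_symmetric[OF A] by blast
  then have in2: "m \<in> theta2_values E w"
    using ge2[of "largest_eigenvalue A"] A by (fastforce simp: theta2_values_def)
  obtain s where s: "s \<in> theta1_values E w" "s \<le> ereal m"
    using theta1_le_of_feasible[OF w A psd] .
  obtain t where t: "t \<in> theta4_values E w" "m \<le> t"
    using theta4_ge_of_edge_free[OF w B] unfolding m_def .
  have t0: "t \<in> theta_values E w" using t(1) theta4_values_subset by blast
  have "ereal t \<le> s" by (rule theta_le_theta1[OF w t0 s(1)])
  then have "ereal t \<le> ereal m" using s(2) by (rule order_trans)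
  then have t_eq: "t = m" using t(2) by simp
  then have s_eq: "s = ereal m" using \<open>ereal t \<le> s\<close> s(2) by (simp add: order_antisym)
  have le0: "x \<le> m" if "x \<in> theta_values E w" for x
    using theta_le_theta1[OF w that s(1)] s_eq by simp
  have le4: "x \<le> m" if "x \<in> theta4_values E w" for x
    using le0 that theta4_values_subset by blast
  have ge1: "ereal m \<le> x" if "x \<in> theta1_values E w" for x
    using theta_le_theta1[OF w t0 that] t_eq by simp
  have in0: "m \<in> theta_values E w" and in1: "ereal m \<in> theta1_values E w"
    and in4: "m \<in> theta4_values E w"
    using t0 s(1) t(1) t_eq s_eq by auto
  have attained: "has_max (theta_values E w)" "has_min (theta1_values E w)"
    "has_min (theta2_values E w)" "has_max (theta3_values E w)" "has_max (theta4_values E w)"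
    unfolding has_max_def has_min_def
    using in0 le0 in1 ge1 in2 ge2 in3 le3 in4 le4 by blast+
  have theta: "theta E w = m"
    unfolding theta_def by (intro Greatest_equality in0 le0)
  moreover have "theta1 E w = ereal m"
    unfolding theta1_def by (intro Least_equality in1 ge1)
  moreover have "theta2 E w = m"
    unfolding theta2_def by (intro Least_equality in2 ge2)
  moreover have "theta3 E w = m"
    unfolding theta3_def by (intro Greatest_equality in3 le3)
  moreover have "theta4 E w = m"
    unfolding theta4_def by (intro Greatest_equality in4 le4)
  moreover have "\<exists>d a d' b. orthogonal_labeling E d a \<and> orthogonal_labeling (complement E) d' b \<and>
      (\<forall>v. cost d (a v) = w $ v / m) \<and> (\<Sum>v\<in>UNIV. cost d (a v) * cost d' (b v)) = 1"
    if w_nonzero: "w \<noteq> 0"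
  proof -
    obtain d a where a: "orthogonal_labeling E d a" "\<And>v. cost d (a v) = w $ v / m"
      by (rule labeling_of_feasible[OF w A psd]) (rule that)
    obtain d' b where b: "orthogonal_labeling (complement E) d' b"
      and m: "m = (\<Sum>v\<in>UNIV. cost d' (b v) * w $ v)"
      using in4 by (auto simp: theta4_values_def)
    obtain v where "w $ v \<noteq> 0" using w_nonzero by (metis vec_eq_iff zero_index)
    then have "m \<noteq> 0" using weight_le_of_feasible[OF A psd, of v] w[of v] by auto
    moreover have "(\<Sum>v\<in>UNIV. cost d (a v) * cost d' (b v))
        = (\<Sum>v\<in>UNIV. cost d' (b v) * w $ v) / m"
      by (simp add: a(2) sum_divide_distrib mult.commute)
    ultimately have "(\<Sum>v\<in>UNIV. cost d (a v) * cost d' (b v)) = 1"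
      by (simp flip: m)
    then show ?thesis using a b by blast
  qed
  ultimately show ?thesis using attained by simp
qed

end
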